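(* Every axiom of $\mathrm{HA}^-$ (i.e. the universal closure of each axiom of Peano arithmetic other than the induction schema) is $\mu$-realised, i.e. for each such sentence $\varphi$ there is a program $p$ with $p\Vdash_\mu\varphi$.
   Context: Formulas are in the first-order language of arithmetic ($0,S,+,\cdot,=$; $\neg\varphi$ abbreviates $\varphi\to\bot$). $\mathrm{HA}^-$ denotes the axioms of Peano arithmetic without the induction schema. Programs are oracle Turing programs, identified with natural-number codes via a fixed computable enumeration; for a program $p$, oracle $u\in 2^\omega$ and $n\in\mathbb N$, $p^u(n)$ is the output of $p$ on input $n$ with oracle $u$. $\mu$ is the Lebesgue (fair-coin) measure on $2^\omega$. $\mu$-realisability: relations $(p,u)\Vdash_O\varphi$ and $p\Vdash_\mu\varphi$ are defined by simultaneous recursion on the sentence $\varphi$: never $(p,u)\Vdash_O\bot$; $(p,u)\Vdash_O t=s$ iff $t,s$ have the same value in $\mathbb N$; $(p,u)\Vdash_O\varphi\wedge\psi$ iff $(p^u(0),u)\Vdash_O\varphi$ and $(p^u(1),u)\Vdash_O\psi$; $(p,u)\Vdash_O\varphi\vee\psi$ iff $p^u(0)=0$ and $(p^u(1),u)\Vdash_O\varphi$, or $p^u(0)=1$ and $(p^u(1),u)\Vdash_O\psi$; $(p,u)\Vdash_O\varphi\to\psi$ iff for every $s$ with $s\Vdash_\mu\varphi$ we have $p^u(s)\Vdash_\mu\psi$; $(p,u)\Vdash_O\exists x\varphi(x)$ iff $(p^u(0),u)\Vdash_O\varphi(p^u(1))$; $(p,u)\Vdash_O\forall x\varphi(x)$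 iff $(p^u(n),u)\Vdash_O\varphi(n)$ for all $n$ (outputs mentioned are required to exist). Let $C_{p,\varphi}=\{u:(p,u)\Vdash_O\varphi\}$; $p\Vdash_\mu\varphi$ iff $\mu(C_{p,\varphi})\ge r$ for some real $r>0$. *)

theory Defs
  imports "HOL-Probability.Probability" "HOL-Library.Nat_Bijection"
begin

section \<open>First-order language of arithmetic\<close>

datatype tm = Var nat | Zero | Succ tm | Add tm tm | Mul tm tm

datatype fm =
    Bot
  | Eq tm tm
  | And fm fm
  | Or fm fm
  | Imp fm fm
  | Exists nat fm
  | Forall nat fm

abbreviation Neg :: "fm \<Rightarrow> fm" where
  "Neg \<phi> \<equiv> Imp \<phi> Bot"

primrec vars_tm :: "tm \<Rightarrow> nat set" where
  "vars_tm (Var x) = {x}"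
| "vars_tm Zero = {}"
| "vars_tm (Succ t) = vars_tm t"
| "vars_tm (Add s t) = vars_tm s \<union> vars_tm t"
| "vars_tm (Mul s t) = vars_tm s \<union> vars_tm t"

primrec free_vars :: "fm \<Rightarrow> nat set" where
  "free_vars Bot = {}"
| "free_vars (Eq s t) = vars_tm s \<union> vars_tm t"
| "free_vars (And \<phi> \<psi>) = free_vars \<phi> \<union> free_vars \<psi>"
| "free_vars (Or \<phi> \<psi>) = free_vars \<phi> \<union> free_vars \<psi>"
| "free_vars (Imp \<phi> \<psi>) = free_vars \<phi> \<union> free_vars \<psi>"
| "free_vars (Exists x \<phi>) = free_vars \<phi> - {x}"
| "free_vars (Forall x \<phi>) = free_vars \<phi> - {x}"

definition sentence :: "fm \<Rightarrow> bool" where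
  "sentence \<phi> \<longleftrightarrow> free_vars \<phi> = {}"

primrec numeral_tm :: "nat \<Rightarrow> tm" where
  "numeral_tm 0 = Zero"
| "numeral_tm (Suc n) = Succ (numeral_tm n)"

text \<open>Only numerals are ever substituted; they are closed terms, so no variable capture can occur.\<close>

primrec subst_tm :: "tm \<Rightarrow> nat \<Rightarrow> nat \<Rightarrow> tm" where
  "subst_tm (Var y) x n = (if y = x then numeral_tm n else Var y)"
| "subst_tm Zero x n = Zero"
| "subst_tm (Succ t) x n = Succ (subst_tm t x n)"
| "subst_tm (Add s t) x n = Add (subst_tm s x n) (subst_tm t x n)"
| "subst_tm (Mul s t) x n = Mul (subst_tm s x n) (subst_tm t x n)"

primrec subst :: "fm \<Rightarrow> nat \<Rightarrow> nat \<Rightarrow> fm" where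
  "subst Bot x n = Bot"
| "subst (Eq s t) x n = Eq (subst_tm s x n) (subst_tm t x n)"
| "subst (And \<phi> \<psi>) x n = And (subst \<phi> x n) (subst \<psi> x n)"
| "subst (Or \<phi> \<psi>) x n = Or (subst \<phi> x n) (subst \<psi> x n)"
| "subst (Imp \<phi> \<psi>) x n = Imp (subst \<phi> x n) (subst \<psi> x n)"
| "subst (Exists y \<phi>) x n = Exists y (if y = x then \<phi> else subst \<phi> x n)"
| "subst (Forall y \<phi>) x n = Forall y (if y = x then \<phi> else subst \<phi> x n)"

text \<open>The value of a closed term; the clause for variables is a dummy, irrelevant for sentences.\<close>

primrec tm_val :: "tm \<Rightarrow> nat" where
  "tm_val (Var x) = 0"
| "tm_val Zero = 0"
| "tm_val (Succ t) = Suc (tm_val t)"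
| "tm_val (Add s t) = tm_val s + tm_val t"
| "tm_val (Mul s t) = tm_val s * tm_val t"


section \<open>The axioms of arithmetic without induction\<close>

definition peano_axioms :: "fm set" where
  "peano_axioms =
    (let x = Var 0; y = Var 1 in
     { Forall 0 (Neg (Eq (Succ x) Zero)),
       Forall 0 (Forall 1 (Imp (Eq (Succ x) (Succ y)) (Eq x y))),
       Forall 0 (Eq (Add x Zero) x),
       Forall 0 (Forall 1 (Eq (Add x (Succ y)) (Succ (Add x y)))),
       Forall 0 (Eq (Mul x Zero) Zero),
       Forall 0 (Forall 1 (Eq (Mul x (Succ y)) (Add (Mul x y) x))) })"

text \<open>
  The equality axioms of the language are counted among the axioms of arithmetic, rather than
  being left to the underlying logic.
\<close>

definition equality_axioms :: "fm set" where
  "equality_axioms =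
    (let x = Var 0; y = Var 1; z = Var 2; w = Var 3 in
     { Forall 0 (Eq x x),
       Forall 0 (Forall 1 (Imp (Eq x y) (Eq y x))),
       Forall 0 (Forall 1 (Forall 2 (Imp (And (Eq x y) (Eq y z)) (Eq x z)))),
       Forall 0 (Forall 1 (Imp (Eq x y) (Eq (Succ x) (Succ y)))),
       Forall 0 (Forall 1 (Forall 2 (Forall 3
         (Imp (And (Eq x y) (Eq z w)) (Eq (Add x z) (Add y w)))))),
       Forall 0 (Forall 1 (Forall 2 (Forall 3
         (Imp (And (Eq x y) (Eq z w)) (Eq (Mul x z) (Mul y w)))))) })"

definition HA_minus :: "fm set" where
  "HA_minus = peano_axioms \<union> equality_axioms"

lemma HA_minus_sentence: "\<phi> \<in> HA_minus \<Longrightarrow> sentence \<phi>"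
  by (auto simp: HA_minus_def peano_axioms_def equality_axioms_def sentence_def Let_def)


section \<open>Oracle Turing programs\<close>

text \<open>
  The machines are those of Soare's textbook (Recursively Enumerable Sets and Degrees, III.1):
  a two-way infinite work tape over blank/1 (\<^term>\<open>False\<close>/\<^term>\<open>True\<close>) and a two-way infinite
  read-only oracle tape, scanned by a single head that moves along both tapes simultaneously.
  The oracle tape carries the oracle on the cells \<open>0, 1, 2, \<dots>\<close> and is blank (\<^term>\<open>None\<close>) on
  the negative cells.  A program is a finite partial map, given as an association list,
  sending (state, oracle symbol, work symbol) to (new state, printed symbol, move).
  The machine starts in state \<open>0\<close> and halts when no instruction applies.
\<close>

type_synonym cantor = "nat \<Rightarrow> bool"

datatype move = MoveL | MoveR

type_synonym instr = "(nat \<times> bool option \<times> bool) \<times> (nat \<times> bool \<times> move)"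

type_synonym prog = "instr list"

type_synonym config = "nat \<times> int \<times> (int \<Rightarrow> bool)"

definition oracle_cell :: "cantor \<Rightarrow> int \<Rightarrow> bool option" where
  "oracle_cell u h = (if h < 0 then None else Some (u (nat h)))"

fun shift :: "move \<Rightarrow> int \<Rightarrow> int" where
  "shift MoveL h = h - 1"
| "shift MoveR h = h + 1"

fun step :: "prog \<Rightarrow> cantor \<Rightarrow> config \<Rightarrow> config option" where
  "step P u (q, h, T) =
    (case map_of P (q, oracle_cell u h, T h) of
       None \<Rightarrow> None
     | Some (q', b, d) \<Rightarrow> Some (q', shift d h, T(h := b)))"

text \<open>The input \<open>n\<close> is presented as \<open>n + 1\<close> consecutive 1s, starting at the scanned cell.\<close>

definition init :: "nat \<Rightarrow> config" where
  "init n = (0, 0, \<lambda>h. 0 \<le> h \<and> h \<le> int n)"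

text \<open>The output is the total number of 1s left on the work tape.\<close>

fun tape_output :: "config \<Rightarrow> nat" where
  "tape_output (q, h, T) = card {i. T i}"

definition prog_outputs :: "prog \<Rightarrow> cantor \<Rightarrow> nat \<Rightarrow> nat \<Rightarrow> bool" where
  "prog_outputs P u n m \<longleftrightarrow>
    (\<exists>c. (\<lambda>c c'. step P u c = Some c')\<^sup>*\<^sup>* (init n) c \<and> step P u c = None \<and> tape_output c = m)"

text \<open>
  Programs are enumerated via the pairing and list codings of \<^theory>\<open>HOL-Library.Nat_Bijection\<close>.
  In an instruction the two states are paired, while the oracle symbol, the work symbol, the
  printed symbol and the move are the digits of a remainder modulo \<open>24 = 3 * 2 * 2 * 2\<close>.
\<close>

definition decode_instr :: "nat \<Rightarrow> instr" where
  "decode_instr e =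
    (let (q, q') = prod_decode (e div 24); d = e mod 24 in
     ((q, if d div 8 = 0 then None else Some (d div 8 = 2), odd (d div 4)),
      (q', odd (d div 2), if odd d then MoveR else MoveL)))"

definition decode_prog :: "nat \<Rightarrow> prog" where
  "decode_prog e = map decode_instr (list_decode e)"

fun encode_instr :: "instr \<Rightarrow> nat" where
  "encode_instr ((q, a, s), (q', b, d)) =
    24 * prod_encode (q, q') +
    (8 * (case a of None \<Rightarrow> 0 | Some v \<Rightarrow> 1 + of_bool v) + 4 * of_bool s +
     2 * of_bool b + of_bool (d = MoveR))"

definition encode_prog :: "prog \<Rightarrow> nat" where
  "encode_prog P = list_encode (map encode_instr P)"

lemma decode_encode_instr [simp]: "decode_instr (encode_instr i) = i"
proof -
  obtain q a s q' b d where i: "i = ((q, a, s), (q', b, d))"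
    by (metis prod.exhaust)
  define k :: nat where "k = 8 * (case a of None \<Rightarrow> 0 | Some v \<Rightarrow> 1 + of_bool v) + 4 * of_bool s +
    2 * of_bool b + of_bool (d = MoveR)"
  have k: "k < 24"
    unfolding k_def by (auto split: option.splits)
  have "encode_instr i = 24 * prod_encode (q, q') + k"
    by (simp add: i k_def)
  with k have div: "encode_instr i div 24 = prod_encode (q, q')" and mod: "encode_instr i mod 24 = k"
    by simp_all
  have "decode_instr (encode_instr i) =
    ((q, if k div 8 = 0 then None else Some (k div 8 = 2), odd (k div 4)),
     (q', odd (k div 2), if odd k then MoveR else MoveL))"
    by (simp add: decode_instr_def div mod Let_def)
  also have "\<dots> = i"
    unfolding i k_def by (cases a; cases d; cases s; cases b; cases "the a") simp_all
  finally show ?thesis .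
qed

lemma decode_encode_prog [simp]: "decode_prog (encode_prog P) = P"
  by (simp add: decode_prog_def encode_prog_def map_idI)

text \<open>\<open>outputs p u n m\<close> says that \<open>p\<^sup>u(n)\<close> is defined and equal to \<open>m\<close>.\<close>

definition outputs :: "nat \<Rightarrow> cantor \<Rightarrow> nat \<Rightarrow> nat \<Rightarrow> bool" where
  "outputs p = prog_outputs (decode_prog p)"

lemma outputs_unique:
  assumes "outputs p u n m" "outputs p u n m'"
  shows "m = m'"
proof -
  let ?R = "\<lambda>c c'. step (decode_prog p) u c = Some c'"
  have "c' = c''" if "?R\<^sup>*\<^sup>* c c'" "?R\<^sup>*\<^sup>* c c''" "step (decode_prog p) u c' = None"
    "step (decode_prog p) u c'' = None" for c c' c''
    using that
  proof (induction rule: converse_rtranclp_induct)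
    case base
    then show ?case by (auto elim: converse_rtranclpE)
  next
    case (step y z)
    from step.prems(1) show ?case
      by (rule converse_rtranclpE) (use step in auto)
  qed
  with assms show ?thesis
    unfolding outputs_def prog_outputs_def by metis
qed


section \<open>Realisability\<close>

definition coin_measure :: "cantor measure" where
  "coin_measure = completion (PiM UNIV (\<lambda>_. measure_pmf (bernoulli_pmf (1/2))))"

primrec fm_size :: "fm \<Rightarrow> nat" where
  "fm_size Bot = 1"
| "fm_size (Eq s t) = 1"
| "fm_size (And \<phi> \<psi>) = fm_size \<phi> + fm_size \<psi> + 1"
| "fm_size (Or \<phi> \<psi>) = fm_size \<phi> + fm_size \<psi> + 1"
| "fm_size (Imp \<phi> \<psi>) = fm_size \<phi> + fm_size \<psi> + 1"
| "fm_size (Exists x \<phi>) = fm_size \<phi> + 1"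
| "fm_size (Forall x \<phi>) = fm_size \<phi> + 1"

lemma fm_size_subst [simp]: "fm_size (subst \<phi> x n) = fm_size \<phi>"
  by (induction \<phi>) auto

text \<open>
  \<^const>\<open>measure\<close> is \<open>0\<close> on non-measurable sets, so the last clause includes measurability of the
  set of realising oracles.
\<close>

function realises_oracle :: "nat \<times> cantor \<Rightarrow> fm \<Rightarrow> bool"  (infix "\<tturnstile>\<^sub>O" 50)
  and realises_measure :: "nat \<Rightarrow> fm \<Rightarrow> bool"  (infix "\<tturnstile>\<^sub>\<mu>" 50)
where
  "(p, u) \<tturnstile>\<^sub>O Bot \<longleftrightarrow> False"
| "(p, u) \<tturnstile>\<^sub>O Eq s t \<longleftrightarrow> tm_val s = tm_val t"
| "(p, u) \<tturnstile>\<^sub>O And \<phi> \<psi> \<longleftrightarrow>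
     (\<exists>a b. outputs p u 0 a \<and> outputs p u 1 b \<and> (a, u) \<tturnstile>\<^sub>O \<phi> \<and> (b, u) \<tturnstile>\<^sub>O \<psi>)"
| "(p, u) \<tturnstile>\<^sub>O Or \<phi> \<psi> \<longleftrightarrow>
     (outputs p u 0 0 \<and> (\<exists>a. outputs p u 1 a \<and> (a, u) \<tturnstile>\<^sub>O \<phi>)) \<or>
     (outputs p u 0 1 \<and> (\<exists>a. outputs p u 1 a \<and> (a, u) \<tturnstile>\<^sub>O \<psi>))"
| "(p, u) \<tturnstile>\<^sub>O Imp \<phi> \<psi> \<longleftrightarrow>
     (\<forall>s. s \<tturnstile>\<^sub>\<mu> \<phi> \<longrightarrow> (\<exists>a. outputs p u s a \<and> a \<tturnstile>\<^sub>\<mu> \<psi>))"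
| "(p, u) \<tturnstile>\<^sub>O Exists x \<phi> \<longleftrightarrow>
     (\<exists>a n. outputs p u 0 a \<and> outputs p u 1 n \<and> (a, u) \<tturnstile>\<^sub>O subst \<phi> x n)"
| "(p, u) \<tturnstile>\<^sub>O Forall x \<phi> \<longleftrightarrow>
     (\<forall>n. \<exists>a. outputs p u n a \<and> (a, u) \<tturnstile>\<^sub>O subst \<phi> x n)"
| "p \<tturnstile>\<^sub>\<mu> \<phi> \<longleftrightarrow> (\<exists>r>0. measure coin_measure {u. (p, u) \<tturnstile>\<^sub>O \<phi>} \<ge> r)"
  by pat_completeness auto
termination
  by (relation "Wellfounded.measure (\<lambda>x. case x of Inl (pu, \<phi>) \<Rightarrow> 2 * fm_size \<phi> | Inr (p, \<phi>) \<Rightarrow> 2 * fm_size \<phi> + 1)")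
    auto

end

theory Submission imports Defs begin

text \<open>
  Every axiom is a universal closure of an equation, or of an implication from a conjunction of
  equations to an equation or to \<open>\<bottom>\<close>.  A true equation is realised by every program, and a
  \<open>\<mu>\<close>-realised conjunction of equations is true.  Hence a program that constantly outputs the code
  of a program that constantly outputs, and so on to the depth of the axiom, realises it with every
  oracle.
\<close>

definition oracle_symbols :: "bool option list" where
  "oracle_symbols = [None, Some False, Some True]"

text \<open>State \<open>0\<close> erases the input; on the blanks behind it, states \<open>0, \<dots>, c - 1\<close> print one 1 each.\<close>

primrec const_prog :: "nat \<Rightarrow> prog" where
  "const_prog 0 = map (\<lambda>a. ((0, a, True), (0, False, MoveR))) oracle_symbols"
| "const_prog (Suc c) =
     const_prog c @ map (\<lambda>a. ((c, a, False), (Suc c, True, MoveR))) oracle_symbols"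

text \<open>The list \<open>oracle_symbols\<close> exhausts \<open>bool option\<close>, so such a
  block of instructions acts alike under every oracle, also on the negative cells.\<close>

lemma map_of_oracle_symbols:
  "map_of (map (\<lambda>a. ((q, a, s), r)) oracle_symbols) k =
    (if fst k = q \<and> snd (snd k) = s then Some r else None)"
proof -
  obtain q' a s' where "k = (q', a, s')"
    by (metis prod.exhaust)
  moreover have "a = None \<or> a = Some False \<or> a = Some True"
    by (cases a) auto
  ultimately show ?thesis
    by (auto simp: oracle_symbols_def)
qed

lemma map_of_const_prog_True: "map_of (const_prog c) (0, a, True) = Some (0, False, MoveR)"
  by (induction c) (simp_all add: map_of_oracle_symbols map_add_def)

lemma map_of_const_prog_False:
  "map_of (const_prog c) (q, a, False) = (if q < c then Some (Suc q, True, MoveR) else None)"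
  by (induction c) (auto simp: map_of_oracle_symbols map_add_def)

text \<open>Induction on the number of erased cells. The bound is \<open>Suc n\<close> because the
  input \<open>n\<close> is written as \<open>n + 1\<close> ones.\<close>

lemma const_prog_erases:
  assumes "k \<le> Suc n"
  shows "(\<lambda>x y. step (const_prog c) u x = Some y)\<^sup>*\<^sup>*
    (init n) (0, int k, \<lambda>h. int k \<le> h \<and> h \<le> int n)"
  using assms
proof (induction k)
  case 0
  then show ?case by (simp add: init_def)
next
  case (Suc k)
  have "(\<lambda>h. int k \<le> h \<and> h \<le> int n)(int k := False) = (\<lambda>h. int (Suc k) \<le> h \<and> h \<le> int n)"
    by (rule ext) auto
  with Suc.prems have "step (const_prog c) u (0, int k, \<lambda>h. int k \<le> h \<and> h \<le> int n) =
      Some (0, int (Suc k), \<lambda>h. int (Suc k) \<le> h \<and> h \<le> int n)"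
    by (simp add: map_of_const_prog_True)
  with Suc.IH[OF Suc_leD[OF Suc.prems]] show ?case
    by (rule rtranclp.rtrancl_into_rtrancl)
qed

text \<open>The state counts the ones printed so far; \<open>m\<close> is the cell where erasing
  stopped.\<close>

lemma const_prog_prints:
  assumes "k \<le> c"
  shows "(\<lambda>x y. step (const_prog c) u x = Some y)\<^sup>*\<^sup>*
    (0, m, \<lambda>_. False) (k, m + int k, \<lambda>h. m \<le> h \<and> h < m + int k)"
  using assms
proof (induction k)
  case 0
  have "(\<lambda>h. m \<le> h \<and> h < m + int 0) = (\<lambda>_. False)"
    by auto
  then show ?case by simp
next
  case (Suc k)
  have "(\<lambda>h. m \<le> h \<and> h < m + int k)(m + int k := True) = (\<lambda>h. m \<le> h \<and> h < m + int (Suc k))"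
    by (rule ext) auto
  with Suc.prems have "step (const_prog c) u (k, m + int k, \<lambda>h. m \<le> h \<and> h < m + int k) =
      Some (Suc k, m + int (Suc k), \<lambda>h. m \<le> h \<and> h < m + int (Suc k))"
    by (simp add: map_of_const_prog_False)
  with Suc.IH[OF Suc_leD[OF Suc.prems]] show ?case
    by (rule rtranclp.rtrancl_into_rtrancl)
qed

lemma prog_outputs_const_prog: "prog_outputs (const_prog c) u n c"
proof -
  let ?R = "\<lambda>x y. step (const_prog c) u x = Some y"
  define m where "m = int (Suc n)"
  define final :: config where "final = (c, m + int c, \<lambda>h. m \<le> h \<and> h < m + int c)"
  have "(\<lambda>h. m \<le> h \<and> h \<le> int n) = (\<lambda>_. False)"
    by (auto simp: m_def)
  then have "?R\<^sup>*\<^sup>* (init n) (0, m, \<lambda>_. False)"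
    using const_prog_erases[of "Suc n" n c u] by (simp add: m_def)
  also have "?R\<^sup>*\<^sup>* (0, m, \<lambda>_. False) final"
    using const_prog_prints[of c c u m] by (simp add: final_def)
  finally have "?R\<^sup>*\<^sup>* (init n) final" .
  \<comment> \<open>The head scans the blank behind the printed block, where state \<open>c\<close>
    has no instruction.\<close>
  moreover have "step (const_prog c) u final = None"
    by (simp add: final_def map_of_const_prog_False)
  moreover have "{h. m \<le> h \<and> h < m + int c} = {m..<m + int c}"
    by auto
  then have "tape_output final = c"
    by (simp add: final_def)
  ultimately show ?thesis
    unfolding prog_outputs_def by blast
qed

definition const_code :: "nat \<Rightarrow> nat" where
  "const_code c = encode_prog (const_prog c)"

lemma outputs_const_code: "outputs (const_code c) u n c"
  by (simp add: outputs_def const_code_def prog_outputs_const_prog)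

lemma measure_coin_measure_UNIV: "measure coin_measure UNIV = 1"
proof -
  interpret product_prob_space "\<lambda>_::nat. measure_pmf (bernoulli_pmf (1/2))" UNIV
    by unfold_locales
  have "measure coin_measure UNIV = measure (PiM UNIV (\<lambda>_::nat. measure_pmf (bernoulli_pmf (1/2)))) UNIV"
    unfolding coin_measure_def
    using sets.top[of "PiM UNIV (\<lambda>_::nat. measure_pmf (bernoulli_pmf (1/2)))"]
    by (intro measure_completion) (simp add: space_PiM)
  also have "\<dots> = 1"
    using P.prob_space by (simp add: space_PiM)
  finally show ?thesis .
qed

lemma realises_measureI:
  assumes "\<And>u. (p, u) \<tturnstile>\<^sub>O \<phi>"
  shows "p \<tturnstile>\<^sub>\<mu> \<phi>"
proof -
  have "{u. (p, u) \<tturnstile>\<^sub>O \<phi>} = UNIV"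
    using assms by blast
  then have "measure coin_measure {u. (p, u) \<tturnstile>\<^sub>O \<phi>} \<ge> 1"
    by (simp only: measure_coin_measure_UNIV)
  then show ?thesis
    unfolding realises_measure.simps using zero_less_one by blast
qed

text \<open>The empty set has measure 0, which is below every positive bound.\<close>

lemma realises_measureD:
  assumes "p \<tturnstile>\<^sub>\<mu> \<phi>"
  shows "\<exists>u. (p, u) \<tturnstile>\<^sub>O \<phi>"
proof (rule ccontr)
  assume "\<nexists>u. (p, u) \<tturnstile>\<^sub>O \<phi>"
  then have "{u. (p, u) \<tturnstile>\<^sub>O \<phi>} = {}"
    by auto
  with assms show False
    by (auto simp del: realises_oracle.simps)
qed

text \<open>The clause for equations depends on neither program nor oracle, so the set of realising
  oracles is everything or empty.\<close>

lemma realises_measure_Eq: "p \<tturnstile>\<^sub>\<mu> Eq s t \<longleftrightarrow> tm_val s = tm_val t"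
  by (metis realises_measureD realises_measureI realises_oracle.simps(2))

lemma realises_measure_And_EqD:
  assumes "p \<tturnstile>\<^sub>\<mu> And (Eq s t) (Eq s' t')"
  shows "tm_val s = tm_val t \<and> tm_val s' = tm_val t'"
  using realises_measureD[OF assms] unfolding realises_oracle.simps by blast

lemma const_code_realises_Forall:
  assumes "\<And>n. (c, u) \<tturnstile>\<^sub>O subst \<phi> x n"
  shows "(const_code c, u) \<tturnstile>\<^sub>O Forall x \<phi>"
  unfolding realises_oracle.simps using assms outputs_const_code by blast

text \<open>The answer \<open>c\<close> ignores the realiser \<open>s\<close> it is given; if \<phi>
  has no realiser, any \<open>c\<close> will do.\<close>

lemma const_code_realises_Imp:
  assumes "\<And>s. s \<tturnstile>\<^sub>\<mu> \<phi> \<Longrightarrow> c \<tturnstile>\<^sub>\<mu> \<psi>"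
  shows "(const_code c, u) \<tturnstile>\<^sub>O Imp \<phi> \<psi>"
  unfolding realises_oracle.simps using assms outputs_const_code by blast

lemma tm_val_numeral_tm [simp]: "tm_val (numeral_tm n) = n"
  by (induction n) auto

lemma subst_tm_numeral_tm [simp]: "subst_tm (numeral_tm m) x n = numeral_tm m"
  by (induction m) auto

theorem theorem4:
  fixes \<phi> :: fm
  assumes "\<phi> \<in> HA_minus"
  shows "\<exists>p. p \<tturnstile>\<^sub>\<mu> \<phi>"
proof -
  note [simp del] = realises_oracle.simps realises_measure.simps
    and [simp] = realises_oracle.simps(2) realises_measure_Eq
    and [dest] = realises_measure_And_EqD
  note axiom = assms[unfolded HA_minus_def peano_axioms_def equality_axioms_def Let_def]
  have "\<exists>p. \<forall>u. (p, u) \<tturnstile>\<^sub>O \<phi>"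
    \<comment> \<open>The witness \<open>p\<close> stays schematic: each quantifier refines it to
      \<open>const_code\<close> of a new unknown. Universally closed equations are finished here by
      arithmetic.\<close>
    apply (insert axiom, elim UnE insertE emptyE; hypsubst; intro exI allI;
        (rule const_code_realises_Forall, simp?)+)
    \<comment> \<open>Premises become equations between numbers. In the axiom that zero is no
      successor the premise is false, so \<bottom> never has to be realised.\<close>
    apply (rule const_code_realises_Imp; fastforce)+
    done
  then show ?thesis
    using realises_measureI by blast
qed

end
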